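(* Let $K$ be a finite simplicial complex and $p\ge 0$. 1. The function $d_p(\alpha,\alpha')=\sqrt{\mathcal{R}_p(\alpha-\alpha',\,\alpha-\alpha')}=\|\mathcal{T}_p(\alpha-\alpha')\|_{C_p}$, for $\alpha,\alpha'\in C_p(K)$, defines a pseudometric on $C_p(K)$. 2. If $\tilde H_p(K)=0$, then the function $\tilde d_p$ defined for $c,c'\in Z_p(K)$ by choosing a chain $\beta\in C_{p+1}(K)$ with $\partial_{p+1}\beta=c-c'$ and setting $\tilde d_p(c,c')=\sqrt{\mathcal{R}_{p+1}(\beta,\beta)}=\|\mathcal{T}_{p+1}(\beta)\|_{C_{p+1}}$ defines a metric on $Z_p(K)$.
   Context: $K$ is a finite simplicial complex with an orientation given by an ordering of its vertices; $K_p$ is its set of $p$-simplices, with weights $w_p:K_p\to\mathbb{R}_{>0}$. $C_p(K)$ is the real vector space spanned by the oriented $p$-simplices ($C_{-1}(K)=0$), with boundary maps $\partial_p:C_p(K)\to C_{p-1}(K)$ and inner product $\langle\sigma,\tau\rangle_{C_p}=w_p(\sigma)^{-1}$ if $\sigma=\tau$ and $0$ otherwise ($\sigma,\tau\in K_p$), extended bilinearly; $\|\cdot\|_{C_p}$ is the associated norm. $\partial_p^{*}$ is the adjoint of $\partial_p$ with respect to these inner products, and $\mathcal{L}^{\mathrm{up}}_{p-1}=\partial_p\partial_p^{*}$ is the up Laplacian on $C_{p-1}(K)$. The effective resistance operator is $\mathcal{T}_p=\partial_p^{*}(\mathcal{L}^{\mathrm{up}}_{p-1})^{+}\partial_p$,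 where $^{+}$ is the Moore–Penrose pseudoinverse with respect to these inner products, and the effective resistance bilinear form on $C_p(K)$ is $\mathcal{R}_p(\alpha,\alpha')=\langle\mathcal{T}_p\alpha,\alpha'\rangle_{C_p}$. The quantity $\mathcal{T}_{p+1}(\beta)$ depends only on the boundary $\partial_{p+1}\beta$, so the value $\tilde d_p(c,c')$ does not depend on which $\beta$ with $\partial_{p+1}\beta=c-c'$ is chosen. $Z_p(K)=\ker\partial_p$ is the space of $p$-cycles; in particular $Z_0(K)=C_0(K)$, which contains the vertices of $K$. $\tilde H_p(K)$ is the reduced homology of $K$ in degree $p$ (with real coefficients). A pseudometric is a function satisfying non-negativity, symmetry, the triangle inequality and $d(x,x)=0$, but possibly vanishing at distinct points.
   Formalization: For p = 0 the metric is claimed only on each set of 0-cycles with a fixed coefficient sum (all vertices lie in one such set), since if the sums of c and c' differ no β with ∂β = c − c' exists (e.g. K a point, c the vertex, c' = 0). *)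

theory Defs
  imports "HOL-Analysis.Abstract_Metric_Spaces" "HOL-Library.Function_Algebras"
begin

section \<open>Simplicial complexes and chains\<close>

text \<open>Vertices are elements of a linearly ordered type; this order is the one that orients the
  complex. The empty set is not a simplex.\<close>

definition finite_simplicial_complex :: "'a set set \<Rightarrow> bool" where
  "finite_simplicial_complex K \<longleftrightarrow>
     finite K \<and> (\<forall>\<sigma>\<in>K. finite \<sigma> \<and> \<sigma> \<noteq> {}) \<and>
     (\<forall>\<sigma>\<in>K. \<forall>\<tau>. \<tau> \<subseteq> \<sigma> \<and> \<tau> \<noteq> {} \<longrightarrow> \<tau> \<in> K)"

text \<open>Degrees are integers so that degree \<open>-1\<close> is covered by the general definitions: no
  simplex has dimension \<open>-1\<close>, so the chain space in that degree is zero.\<close>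

definition simplices :: "'a set set \<Rightarrow> int \<Rightarrow> 'a set set" where
  "simplices K p = {\<sigma> \<in> K. int (card \<sigma>) = p + 1}"

text \<open>A chain is its coefficient function in the basis of increasingly oriented simplices,
  extended by zero to sets that are not \<open>p\<close>-simplices. Sums, differences and the zero of chains
  are the pointwise ones.\<close>

definition chain_space :: "'a set set \<Rightarrow> int \<Rightarrow> ('a set \<Rightarrow> real) set" where
  "chain_space K p = {c. \<forall>\<sigma>. \<sigma> \<notin> simplices K p \<longrightarrow> c \<sigma> = 0}"

text \<open>The \<open>i\<close>-th vertex of \<open>\<sigma>\<close> (counting from 0) is the vertex \<open>v\<close> that has exactly \<open>i\<close> smaller
  vertices in \<open>\<sigma>\<close>, so the sign is the usual \<open>(-1)^i\<close>. The restriction to \<open>\<tau>\<close> in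
  \<open>simplices K (p - 1)\<close> makes the boundary map of degree 0 zero (for \<open>p = 0\<close> the only face
  would be the empty set).\<close>

definition boundary ::
    "'a::linorder set set \<Rightarrow> int \<Rightarrow> ('a set \<Rightarrow> real) \<Rightarrow> ('a set \<Rightarrow> real)" where
  "boundary K p c = (\<lambda>\<tau>. if \<tau> \<in> simplices K (p - 1)
     then \<Sum>\<sigma>\<in>simplices K p. \<Sum>v\<in>\<sigma>.
            if \<tau> = \<sigma> - {v} then (-1) ^ card {u \<in> \<sigma>. u < v} * c \<sigma> else 0
     else 0)"

definition cycles :: "'a::linorder set set \<Rightarrow> int \<Rightarrow> ('a set \<Rightarrow> real) set" where
  "cycles K p = {c \<in> chain_space K p. boundary K p c = 0}"

definition boundaries :: "'a::linorder set set \<Rightarrow> int \<Rightarrow> ('a set \<Rightarrow> real) set" where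
  "boundaries K p = boundary K (p + 1) ` chain_space K (p + 1)"


section \<open>Reduced homology\<close>

definition augmentation :: "'a set set \<Rightarrow> ('a set \<Rightarrow> real) \<Rightarrow> real" where
  "augmentation K c = (\<Sum>\<sigma>\<in>simplices K 0. c \<sigma>)"

text \<open>Cycles of the augmented chain complex in degrees \<open>p \<ge> 0\<close>, the only ones used here.\<close>

definition reduced_cycles :: "'a::linorder set set \<Rightarrow> int \<Rightarrow> ('a set \<Rightarrow> real) set" where
  "reduced_cycles K p = {c \<in> cycles K p. p = 0 \<longrightarrow> augmentation K c = 0}"

definition homologous ::
    "'a::linorder set set \<Rightarrow> int \<Rightarrow> (('a set \<Rightarrow> real) \<times> ('a set \<Rightarrow> real)) set" where
  "homologous K p =
     {(z, z'). z \<in> reduced_cycles K p \<and> z' \<in> reduced_cycles K p \<and> z - z' \<in> boundaries K p}"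

text \<open>The set of cosets of the boundaries in the reduced cycles. The coset of \<open>0\<close> is
  \<open>boundaries K p\<close> itself, so vanishing reduced homology reads
  \<open>reduced_homology K p = {boundaries K p}\<close>.\<close>

definition reduced_homology :: "'a::linorder set set \<Rightarrow> int \<Rightarrow> ('a set \<Rightarrow> real) set set" where
  "reduced_homology K p = reduced_cycles K p // homologous K p"


section \<open>Linear maps between subspaces of a function space\<close>

text \<open>Subspaces \<open>V\<close>, \<open>W\<close> of function spaces carry inner products \<open>ipV\<close>, \<open>ipW\<close> that need
  not be the restriction of an inner product on the whole type, so the class-based notions of
  the library do not apply. Only values of maps on the given subspaces matter.\<close>

definition linear_map_on ::
    "('b \<Rightarrow> real) set \<Rightarrow> ('c \<Rightarrow> real) set \<Rightarrow> (('b \<Rightarrow> real) \<Rightarrow> ('c \<Rightarrow> real)) \<Rightarrow> bool" where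
  "linear_map_on V W f \<longleftrightarrow>
     (\<forall>x\<in>V. f x \<in> W) \<and> (\<forall>x\<in>V. \<forall>y\<in>V. f (x + y) = f x + f y) \<and>
     (\<forall>r. \<forall>x\<in>V. f (\<lambda>i. r * x i) = (\<lambda>j. r * f x j))"

definition is_adjoint_on ::
    "('b \<Rightarrow> real) set \<Rightarrow> (('b \<Rightarrow> real) \<Rightarrow> ('b \<Rightarrow> real) \<Rightarrow> real) \<Rightarrow>
     ('c \<Rightarrow> real) set \<Rightarrow> (('c \<Rightarrow> real) \<Rightarrow> ('c \<Rightarrow> real) \<Rightarrow> real) \<Rightarrow>
     (('b \<Rightarrow> real) \<Rightarrow> ('c \<Rightarrow> real)) \<Rightarrow> (('c \<Rightarrow> real) \<Rightarrow> ('b \<Rightarrow> real)) \<Rightarrow> bool" where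
  "is_adjoint_on V ipV W ipW f g \<longleftrightarrow>
     linear_map_on W V g \<and> (\<forall>x\<in>V. \<forall>y\<in>W. ipW (f x) y = ipV x (g y))"

text \<open>For a linear map between finite-dimensional inner product spaces the adjoint and the
  pseudoinverse exist and are unique on the subspace where they live, so the choices below are
  determined there.\<close>

definition adjoint_on where
  "adjoint_on V ipV W ipW f = (SOME g. is_adjoint_on V ipV W ipW f g)"

text \<open>The four Penrose conditions.\<close>

definition is_pseudoinverse_on ::
    "('b \<Rightarrow> real) set \<Rightarrow> (('b \<Rightarrow> real) \<Rightarrow> ('b \<Rightarrow> real) \<Rightarrow> real) \<Rightarrow>
     ('c \<Rightarrow> real) set \<Rightarrow> (('c \<Rightarrow> real) \<Rightarrow> ('c \<Rightarrow> real) \<Rightarrow> real) \<Rightarrow>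
     (('b \<Rightarrow> real) \<Rightarrow> ('c \<Rightarrow> real)) \<Rightarrow> (('c \<Rightarrow> real) \<Rightarrow> ('b \<Rightarrow> real)) \<Rightarrow> bool" where
  "is_pseudoinverse_on V ipV W ipW f g \<longleftrightarrow>
     linear_map_on W V g \<and>
     (\<forall>x\<in>V. f (g (f x)) = f x) \<and>
     (\<forall>y\<in>W. g (f (g y)) = g y) \<and>
     (\<forall>y\<in>W. \<forall>y'\<in>W. ipW (f (g y)) y' = ipW y (f (g y'))) \<and>
     (\<forall>x\<in>V. \<forall>x'\<in>V. ipV (g (f x)) x' = ipV x (g (f x')))"

definition pseudoinverse_on where
  "pseudoinverse_on V ipV W ipW f = (SOME g. is_pseudoinverse_on V ipV W ipW f g)"


section \<open>Effective resistance\<close>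

text \<open>One function \<open>w\<close> on all simplices stands for the family of the \<open>w\<^sub>p\<close>, which have disjoint
  domains.\<close>

definition chain_inner ::
    "'a set set \<Rightarrow> ('a set \<Rightarrow> real) \<Rightarrow> int \<Rightarrow> ('a set \<Rightarrow> real) \<Rightarrow> ('a set \<Rightarrow> real) \<Rightarrow> real" where
  "chain_inner K w p \<alpha> \<beta> = (\<Sum>\<sigma>\<in>simplices K p. \<alpha> \<sigma> * \<beta> \<sigma> * inverse (w \<sigma>))"

definition chain_norm ::
    "'a set set \<Rightarrow> ('a set \<Rightarrow> real) \<Rightarrow> int \<Rightarrow> ('a set \<Rightarrow> real) \<Rightarrow> real" where
  "chain_norm K w p \<alpha> = sqrt (chain_inner K w p \<alpha> \<alpha>)"

definition coboundary ::
    "'a::linorder set set \<Rightarrow> ('a set \<Rightarrow> real) \<Rightarrow> int \<Rightarrow> ('a set \<Rightarrow> real) \<Rightarrow> ('a set \<Rightarrow> real)" where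
  "coboundary K w p = adjoint_on (chain_space K p) (chain_inner K w p)
     (chain_space K (p - 1)) (chain_inner K w (p - 1)) (boundary K p)"

definition up_laplacian ::
    "'a::linorder set set \<Rightarrow> ('a set \<Rightarrow> real) \<Rightarrow> int \<Rightarrow> ('a set \<Rightarrow> real) \<Rightarrow> ('a set \<Rightarrow> real)" where
  "up_laplacian K w q = boundary K (q + 1) \<circ> coboundary K w (q + 1)"

definition resistance_operator ::
    "'a::linorder set set \<Rightarrow> ('a set \<Rightarrow> real) \<Rightarrow> int \<Rightarrow> ('a set \<Rightarrow> real) \<Rightarrow> ('a set \<Rightarrow> real)" where
  "resistance_operator K w p =
     coboundary K w p \<circ>
     pseudoinverse_on (chain_space K (p - 1)) (chain_inner K w (p - 1))
       (chain_space K (p - 1)) (chain_inner K w (p - 1)) (up_laplacian K w (p - 1)) \<circ>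
     boundary K p"

definition resistance_form ::
    "'a::linorder set set \<Rightarrow> ('a set \<Rightarrow> real) \<Rightarrow> int \<Rightarrow>
     ('a set \<Rightarrow> real) \<Rightarrow> ('a set \<Rightarrow> real) \<Rightarrow> real" where
  "resistance_form K w p \<alpha> \<alpha>' = chain_inner K w p (resistance_operator K w p \<alpha>) \<alpha>'"

definition chain_dist ::
    "'a::linorder set set \<Rightarrow> ('a set \<Rightarrow> real) \<Rightarrow> int \<Rightarrow>
     ('a set \<Rightarrow> real) \<Rightarrow> ('a set \<Rightarrow> real) \<Rightarrow> real" where
  "chain_dist K w p \<alpha> \<alpha>' = sqrt (resistance_form K w p (\<alpha> - \<alpha>') (\<alpha> - \<alpha>'))"

text \<open>The value 0 where \<open>c - c'\<close> is not a boundary is a convention outside the domain of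
  definition; it is chosen because the locale \<open>Metric_space\<close> asks for a function that is
  non-negative and symmetric on the whole type. Two cycles of positive degree always differ by a
  boundary if the reduced homology vanishes; in degree 0 (all 0-chains are cycles) they do exactly
  if their augmentations agree, as is the case for any two vertices.\<close>

definition cycle_dist ::
    "'a::linorder set set \<Rightarrow> ('a set \<Rightarrow> real) \<Rightarrow> int \<Rightarrow>
     ('a set \<Rightarrow> real) \<Rightarrow> ('a set \<Rightarrow> real) \<Rightarrow> real" where
  "cycle_dist K w p c c' =
     (if \<exists>\<beta>\<in>chain_space K (p + 1). boundary K (p + 1) \<beta> = c - c'
      then let \<beta> = SOME \<beta>. \<beta> \<in> chain_space K (p + 1) \<and> boundary K (p + 1) \<beta> = c - c'
           in sqrt (resistance_form K w (p + 1) \<beta> \<beta>)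
      else 0)"

definition pseudometric_on :: "'b set \<Rightarrow> ('b \<Rightarrow> 'b \<Rightarrow> real) \<Rightarrow> bool" where
  "pseudometric_on M d \<longleftrightarrow>
     (\<forall>x\<in>M. \<forall>y\<in>M. 0 \<le> d x y) \<and> (\<forall>x\<in>M. d x x = 0) \<and>
     (\<forall>x\<in>M. \<forall>y\<in>M. d x y = d y x) \<and>
     (\<forall>x\<in>M. \<forall>y\<in>M. \<forall>z\<in>M. d x z \<le> d x y + d y z)"

end

theory Submission
  imports Defs "HOL-Analysis.L2_Norm"
begin

text \<open>Write \<open>D\<close> for the boundary map in the degree at hand, \<open>D*\<close> for its adjoint, \<open>P\<close> for the
  pseudoinverse of \<open>D D*\<close>, and \<open>T = D* P D\<close> for the effective resistance operator. The whole
  theorem rests on two identities: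

  \<^item> \<open>D T = D\<close> (lemma \<open>gram_P_f\<close>): the operator \<open>D D* P\<close> is the orthogonal projection to the range
    of \<open>D D*\<close>, and this range is the range of \<open>D\<close>.
  \<^item> \<open>\<langle>T a, b\<rangle> = \<langle>T a, T b\<rangle>\<close> (lemma \<open>resistance_form_eq\<close>): both sides equal \<open>\<langle>P D a, D b\<rangle>\<close>, by
    adjunction and the first identity.

  So \<open>T\<close> is the orthogonal projection to the complement of the kernel of \<open>D\<close>. The second identity
  gives \<open>sqrt (R(a, a)) = \<parallel>T a\<parallel>\<close>; as \<open>T\<close> is linear this is a seminorm, and a seminorm induces a
  pseudometric. As \<open>T\<close> begins with \<open>D\<close>, the value \<open>T b\<close> depends only on \<open>D b\<close>, so the distance of
  two cycles is the same for every filling \<open>b\<close> of their difference. By the first identity \<open>T b = 0\<close>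
  forces \<open>D b = 0\<close>, that is, cycles at distance 0 are equal. Vanishing reduced homology
  provides the fillings, in degree 0 for cycles of equal augmentation.

  The operators \<open>D*\<close> and \<open>P\<close> are chosen among all maps that satisfy their defining conditions, so
  these identities need the existence of such maps. Both follow from the Riesz representation
  theorem on a finitely spanned space (lemma \<open>riesz_on_finite_span\<close>). It gives the adjoint
  directly (lemma \<open>exists_adjoint\<close>); applied to the functionals \<open>\<langle>y, _\<rangle>\<close> it gives orthogonal
  projections, and with them the least squares solutions that make up the pseudoinverse (lemma
  \<open>exists_pseudoinverse\<close>).\<close>

section \<open>Finite-dimensional inner product spaces of functions\<close>

text \<open>The scaling is the one that \<^const>\<open>linear_map_on\<close> uses, so that spans and subspaces fit it.\<close>

interpretation fun_vs: vector_space "\<lambda>(r::real) (f::'b \<Rightarrow> real) i. r * f i"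
  by unfold_locales (auto simp: fun_eq_iff algebra_simps)

text \<open>Induction and unification produce eta-expanded zeros, which simplify to \<open>\<lambda>_. 0\<close>; this brings
  them back to the constant.\<close>

lemma zero_fun_eta [simp]: "(\<lambda>_. 0) = (0 :: 'b \<Rightarrow> real)"
  by (simp add: fun_eq_iff)

text \<open>The whole space \<open>'b \<Rightarrow> real\<close> may be infinite-dimensional; only \<open>V\<close> is finitely spanned, and the
  form \<open>ip\<close> is constrained only there.\<close>

locale fin_inner_space =
  fixes V :: "('b \<Rightarrow> real) set" and ip :: "('b \<Rightarrow> real) \<Rightarrow> ('b \<Rightarrow> real) \<Rightarrow> real"
  assumes finite_span: "\<exists>B. finite B \<and> fun_vs.span B = V"
    and ip_commute: "x \<in> V \<Longrightarrow> y \<in> V \<Longrightarrow> ip x y = ip y x"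
    and ip_add_left: "x \<in> V \<Longrightarrow> y \<in> V \<Longrightarrow> z \<in> V \<Longrightarrow> ip (x + y) z = ip x z + ip y z"
    and ip_scale_left: "x \<in> V \<Longrightarrow> z \<in> V \<Longrightarrow> ip (\<lambda>i. r * x i) z = r * ip x z"
    and ip_ge_0: "x \<in> V \<Longrightarrow> 0 \<le> ip x x"
    and ip_eq_0: "x \<in> V \<Longrightarrow> ip x x = 0 \<Longrightarrow> x = 0"
begin

lemma subspace: "fun_vs.subspace V"
  using finite_span fun_vs.subspace_span by auto

lemma closed [simp]:
  "0 \<in> V"
  "x \<in> V \<Longrightarrow> y \<in> V \<Longrightarrow> x + y \<in> V"
  "x \<in> V \<Longrightarrow> y \<in> V \<Longrightarrow> x - y \<in> V"
  "x \<in> V \<Longrightarrow> (\<lambda>i. r * x i) \<in> V"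
  using subspace fun_vs.subspace_0 fun_vs.subspace_add fun_vs.subspace_diff
    fun_vs.subspace_scale by blast+

lemma ip_add_right: "x \<in> V \<Longrightarrow> y \<in> V \<Longrightarrow> z \<in> V \<Longrightarrow> ip z (x + y) = ip z x + ip z y"
  using ip_add_left ip_commute by simp

lemma ip_scale_right: "x \<in> V \<Longrightarrow> z \<in> V \<Longrightarrow> ip z (\<lambda>i. r * x i) = r * ip z x"
  using ip_scale_left ip_commute by simp

lemma ip_diff_left: "x \<in> V \<Longrightarrow> y \<in> V \<Longrightarrow> z \<in> V \<Longrightarrow> ip (x - y) z = ip x z - ip y z"
  using ip_add_left[of "x - y" y z] by simp

lemma ip_diff_right: "x \<in> V \<Longrightarrow> y \<in> V \<Longrightarrow> z \<in> V \<Longrightarrow> ip z (x - y) = ip z x - ip z y"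
  using ip_diff_left ip_commute by simp

lemma ip_zero_left [simp]: "z \<in> V \<Longrightarrow> ip 0 z = 0"
  using ip_add_left[of 0 0 z] by simp

lemma ip_zero_right [simp]: "z \<in> V \<Longrightarrow> ip z 0 = 0"
  using ip_commute[of 0 z] by simp

lemma eq_if_all_ip_eq:
  assumes "x \<in> V" "y \<in> V" "\<And>z. z \<in> V \<Longrightarrow> ip z x = ip z y"
  shows "x = y"
  using ip_eq_0[of "x - y"] ip_diff_right[of x y "x - y"] assms by simp

text \<open>By induction on the spanning set. To add a vector \<open>s\<close> to the
  spanning set, apply the induction hypothesis to the functional \<open>ip s\<close>: this yields the
  projection \<open>s0\<close> of \<open>s\<close> to the old span. The representing vector is then corrected by a multiple
  of the new orthogonal direction \<open>s - s0\<close>, as in the Gram-Schmidt process. Quantifying over the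
  functional is what makes this possible, and it makes orthogonal projection the special case of
  the functional \<open>ip y\<close>.\<close>

lemma riesz_on_finite_span:
  assumes "finite S" "S \<subseteq> V"
    and "\<And>x y. x \<in> V \<Longrightarrow> y \<in> V \<Longrightarrow> \<phi> (x + y) = \<phi> x + (\<phi> y :: real)"
    and "\<And>r x. x \<in> V \<Longrightarrow> \<phi> (\<lambda>i. r * x i) = r * \<phi> x"
  shows "\<exists>v\<in>fun_vs.span S. \<forall>u\<in>fun_vs.span S. ip v u = \<phi> u"
  using assms
proof (induction S arbitrary: \<phi> rule: finite_induct)
  case empty
  have "\<phi> (0 + 0) = \<phi> 0 + \<phi> 0" by (rule empty.prems(2)) (rule closed)+
  then have "\<phi> 0 = 0" by simp
  then show ?case by simp
next
  case (insert s S)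
  have add: "\<phi> (x + y) = \<phi> x + \<phi> y" if "x \<in> V" "y \<in> V" for x y
    using that by (rule insert.prems(2))
  have scale: "\<phi> (\<lambda>i. r * x i) = r * \<phi> x" if "x \<in> V" for x r
    using that by (rule insert.prems(3))
  have s: "s \<in> V" and S: "S \<subseteq> V" using insert.prems by auto
  have sub: "fun_vs.span S \<subseteq> V" using S subspace fun_vs.span_minimal by blast
  have mono: "fun_vs.span S \<subseteq> fun_vs.span (insert s S)"
    by (rule fun_vs.span_mono) blast
  obtain v where v: "v \<in> fun_vs.span S" "\<And>u. u \<in> fun_vs.span S \<Longrightarrow> ip v u = \<phi> u"
    using insert.IH[of \<phi>, OF S add scale] by blast
  obtain s0 where s0: "s0 \<in> fun_vs.span S" "\<And>u. u \<in> fun_vs.span S \<Longrightarrow> ip s0 u = ip s u"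
    using insert.IH[of "ip s", OF S] s ip_add_right ip_scale_right by blast
  define s' where "s' = s - s0"
  have V: "v \<in> V" "s0 \<in> V" "s' \<in> V" using v s0 sub s by (auto simp: s'_def)
  have s_eq: "s = s0 + s'" by (simp add: s'_def)
  have orth: "ip s' u = 0" if "u \<in> fun_vs.span S" for u
    using that s0(2) sub V s by (auto simp: s'_def ip_diff_left)
  define c where "c = (\<phi> s' - ip v s') / ip s' s'"
  \<comment> \<open>If \<open>s\<close> already lies in the old span then \<open>s' = 0\<close> and \<open>c = 0\<close>, the value of a division by 0.\<close>
  have c: "c * ip s' s' = \<phi> s' - ip v s'"
  proof (cases "ip s' s' = 0")
    case True
    then have "s' = 0" using ip_eq_0 V by blast
    moreover have "\<phi> 0 = 0" using add[of 0 0] by simp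
    ultimately show ?thesis using V by simp
  qed (simp add: c_def)
  define v' where "v' = v + (\<lambda>i. c * s' i)"
  have v'V: "v' \<in> V" using V by (simp add: v'_def)
  have "s' \<in> fun_vs.span (insert s S)"
    unfolding s'_def using s0(1) mono
    by (intro fun_vs.span_diff[OF fun_vs.span_base]) auto
  then have v'_span: "v' \<in> fun_vs.span (insert s S)"
    unfolding v'_def using v mono by (intro fun_vs.span_add fun_vs.span_scale) auto
  have old: "ip v' u = \<phi> u" if "u \<in> fun_vs.span S" for u
    using that v(2) orth V sub by (auto simp: v'_def ip_add_left ip_scale_left)
  have "ip v' s' = \<phi> s'"
    using V c by (simp add: v'_def ip_add_left ip_scale_left)
  then have new: "ip v' s = \<phi> s"
    unfolding s_eq using old[OF s0(1)] V v'V add[of s0 s'] by (simp add: ip_add_right)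
  define A where "A = {u \<in> V. ip v' u = \<phi> u}"
  have "fun_vs.subspace A"
    unfolding A_def fun_vs.subspace_def
    using v'V add[of 0 0] add scale by (auto simp: ip_add_right ip_scale_right)
  moreover have "insert s S \<subseteq> A"
    using new old s S by (auto simp: A_def fun_vs.span_base)
  ultimately have "fun_vs.span (insert s S) \<subseteq> A" by (rule fun_vs.span_minimal[rotated])
  then show ?case using v'_span by (auto simp: A_def)
qed

end

lemma linear_map_onD:
  assumes "linear_map_on V W f"
  shows "x \<in> V \<Longrightarrow> f x \<in> W"
    and "x \<in> V \<Longrightarrow> y \<in> V \<Longrightarrow> f (x + y) = f x + f y"
    and "x \<in> V \<Longrightarrow> f (\<lambda>i. r * x i) = (\<lambda>j. r * f x j)"
  using assms by (auto simp: linear_map_on_def)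

lemma linear_map_on_zero:
  assumes "linear_map_on V W f" "0 \<in> V"
  shows "f 0 = 0"
  using linear_map_onD(2)[OF assms(1), of 0 0] assms(2) by simp

lemma linear_map_on_diff:
  assumes "linear_map_on V W f" "fun_vs.subspace V" "x \<in> V" "y \<in> V"
  shows "f (x - y) = f x - f y"
  using linear_map_onD(2)[OF assms(1), of "x - y" y] fun_vs.subspace_diff[OF assms(2-4)] assms(4)
  by (simp add: eq_diff_eq)

lemma linear_map_on_compose:
  assumes "linear_map_on U V f" "linear_map_on V W g"
  shows "linear_map_on U W (g \<circ> f)"
  using assms by (auto simp: linear_map_on_def)

lemma image_eq_span_image:
  assumes "linear_map_on (fun_vs.span B) W f"
  shows "f ` fun_vs.span B = fun_vs.span (f ` B)"
proof
  let ?V = "fun_vs.span B"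
  note f = linear_map_onD[OF assms]
  note f0 = linear_map_on_zero[OF assms fun_vs.span_zero]
  define A where "A = {x \<in> ?V. f x \<in> fun_vs.span (f ` B)}"
  have "fun_vs.subspace A"
    unfolding A_def fun_vs.subspace_def
    using f(2,3) f0
    by (auto simp: fun_vs.span_zero fun_vs.span_add fun_vs.span_scale)
  moreover have "B \<subseteq> A" by (auto simp: A_def fun_vs.span_base)
  ultimately have "?V \<subseteq> A" by (rule fun_vs.span_minimal[rotated])
  then show "f ` ?V \<subseteq> fun_vs.span (f ` B)" by (auto simp: A_def)
  have "fun_vs.subspace (f ` ?V)"
    unfolding fun_vs.subspace_def
  proof (intro conjI allI ballI)
    show "0 \<in> f ` ?V" using imageI[OF fun_vs.span_zero[of B], of f] f0 by simp
    show "x + y \<in> f ` ?V" if xy: "x \<in> f ` ?V" "y \<in> f ` ?V" for x y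
    proof -
      obtain a b where ab: "a \<in> ?V" "x = f a" "b \<in> ?V" "y = f b" using xy by blast
      then have "x + y = f (a + b)" using f(2) by simp
      then show ?thesis using fun_vs.span_add[OF ab(1,3)] by blast
    qed
    show "(\<lambda>i. r * x i) \<in> f ` ?V" if x: "x \<in> f ` ?V" for r x
    proof -
      obtain a where a: "a \<in> ?V" "x = f a" using x by blast
      then have "(\<lambda>i. r * x i) = f (\<lambda>i. r * a i)" using f(3) by simp
      then show ?thesis using fun_vs.span_scale[OF a(1)] by blast
    qed
  qed
  then show "fun_vs.span (f ` B) \<subseteq> f ` ?V"
    by (intro fun_vs.span_minimal) (auto simp: fun_vs.span_base)
qed

section \<open>Existence of adjoints and pseudoinverses\<close>

text \<open>The value of the adjoint at \<open>y\<close> is the Riesz representative of \<open>\<lambda>x. ipW (f x) y\<close>; it is linear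
  in \<open>y\<close> because representatives are unique.\<close>

lemma exists_adjoint:
  assumes "fin_inner_space V ipV" "fin_inner_space W ipW" and f: "linear_map_on V W f"
  shows "\<exists>g. is_adjoint_on V ipV W ipW f g"
proof -
  interpret V: fin_inner_space V ipV by fact
  interpret W: fin_inner_space W ipW by fact
  note fD = linear_map_onD[OF f]
  obtain B where B: "finite B" "fun_vs.span B = V" using V.finite_span by blast
  have BV: "B \<subseteq> V" using B(2) fun_vs.span_superset by blast
  have "\<exists>v\<in>V. \<forall>x\<in>V. ipV v x = ipW (f x) y" if "y \<in> W" for y
    using V.riesz_on_finite_span[OF B(1) BV, of "\<lambda>x. ipW (f x) y"] that
    by (auto simp: B(2) fD W.ip_add_left W.ip_scale_left)
  then obtain g where g: "\<And>y. y \<in> W \<Longrightarrow> g y \<in> V"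
    "\<And>x y. y \<in> W \<Longrightarrow> x \<in> V \<Longrightarrow> ipV (g y) x = ipW (f x) y"
    by metis
  have g': "ipV x (g y) = ipW (f x) y" if "y \<in> W" "x \<in> V" for x y
    using g that V.ip_commute by simp
  have "linear_map_on W V g"
    unfolding linear_map_on_def
  proof (intro conjI ballI allI)
    show "g y \<in> V" if "y \<in> W" for y using g that by blast
    show "g (x + y) = g x + g y" if "x \<in> W" "y \<in> W" for x y
      by (rule V.eq_if_all_ip_eq)
        (use that g g' fD(1) in \<open>simp_all add: V.ip_add_right W.ip_add_right\<close>)
    show "g (\<lambda>i. r * x i) = (\<lambda>j. r * g x j)" if "x \<in> W" for r x
      by (rule V.eq_if_all_ip_eq)
        (use that g g' fD(1) in \<open>simp_all add: V.ip_scale_right W.ip_scale_right\<close>)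
  qed
  then show ?thesis using g' by (auto simp: is_adjoint_on_def)
qed

locale adjoint_pair =
  V: fin_inner_space V ipV + W: fin_inner_space W ipW
  for V :: "('b \<Rightarrow> real) set" and ipV and W :: "('c \<Rightarrow> real) set" and ipW +
  fixes f :: "('b \<Rightarrow> real) \<Rightarrow> ('c \<Rightarrow> real)" and g :: "('c \<Rightarrow> real) \<Rightarrow> ('b \<Rightarrow> real)"
  assumes lin: "linear_map_on V W f"
    and adj: "is_adjoint_on V ipV W ipW f g"
begin

lemma lin_adj: "linear_map_on W V g"
  and adjoint: "x \<in> V \<Longrightarrow> y \<in> W \<Longrightarrow> ipW (f x) y = ipV x (g y)"
  using adj by (auto simp: is_adjoint_on_def)

lemmas f_simps [simp] = linear_map_onD[OF lin] linear_map_on_zero[OF lin V.closed(1)]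
  linear_map_on_diff[OF lin V.subspace]
lemmas g_simps [simp] = linear_map_onD[OF lin_adj] linear_map_on_zero[OF lin_adj W.closed(1)]
  linear_map_on_diff[OF lin_adj W.subspace]

lemma swap: "adjoint_pair W ipW V ipV g f"
proof
  show "is_adjoint_on W ipW V ipV g f"
    using lin adjoint V.ip_commute W.ip_commute by (simp add: is_adjoint_on_def)
qed (rule lin_adj)

text \<open>This is \<open>\<langle>f x, f x\<rangle> = \<langle>x, g (f x)\<rangle>\<close>.\<close>

lemma f_eq_0_if_g_f_eq_0:
  assumes "x \<in> V" "g (f x) = 0"
  shows "f x = 0"
  using adjoint[of x "f x"] assms W.ip_eq_0 by simp

text \<open>The solution is a least squares solution of \<open>f x = y\<close>: for the projection \<open>f x\<close> of \<open>y\<close> to the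
  range of \<open>f\<close>, the difference \<open>y - f x\<close> is orthogonal to that range, so \<open>g\<close> maps it to 0.\<close>

lemma exists_normal_equation_solution:
  assumes "y \<in> W"
  shows "\<exists>x\<in>V. g (f x) = g y"
proof -
  obtain B where B: "finite B" "fun_vs.span B = V" using V.finite_span by blast
  have image: "fun_vs.span (f ` B) = f ` V"
    using image_eq_span_image[of B W f] lin B(2) by simp
  have "B \<subseteq> V" using B(2) fun_vs.span_superset by blast
  then have "f ` B \<subseteq> W" by auto
  then have "\<exists>z\<in>fun_vs.span (f ` B). \<forall>u\<in>fun_vs.span (f ` B). ipW z u = ipW y u"
    using B(1) assms
    by (intro W.riesz_on_finite_span) (simp_all add: W.ip_add_right W.ip_scale_right)
  then obtain x where x: "x \<in> V" "\<And>u. u \<in> V \<Longrightarrow> ipW (f x) (f u) = ipW y (f u)"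
    unfolding image by blast
  have "ipV u (g (f x)) = ipV u (g y)" if "u \<in> V" for u
    using x that assms W.ip_commute by (simp flip: adjoint)
  then have "g (f x) = g y"
    by (rule V.eq_if_all_ip_eq[rotated 2]) (use x assms in auto)
  then show ?thesis using x by blast
qed

text \<open>Projecting a solution of the normal equation to the range of \<open>g\<close> leaves its image under \<open>f\<close>
  alone, and the range of \<open>g\<close> meets the kernel of \<open>f\<close> only in 0. So there is exactly one solution
  in that range, and this is the value of the pseudoinverse at \<open>y\<close>.\<close>

lemma exists_solution_in_range:
  assumes "y \<in> W"
  shows "\<exists>u\<in>W. g (f (g u)) = g y"
proof -
  interpret S: adjoint_pair W ipW V ipV g f by (rule swap)
  obtain x where x: "x \<in> V" "g (f x) = g y"
    using exists_normal_equation_solution[OF assms] by blast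
  obtain u where "u \<in> W" "f (g u) = f x"
    using S.exists_normal_equation_solution[OF x(1)] by blast
  then show ?thesis using x by (intro bexI[of _ u]) simp_all
qed

lemma solution_in_range_unique:
  assumes "u \<in> W" "u' \<in> W" "g (f (g u)) = g (f (g u'))"
  shows "g u = g u'"
proof -
  interpret S: adjoint_pair W ipW V ipV g f by (rule swap)
  have "f (g (u - u')) = 0"
    by (rule f_eq_0_if_g_f_eq_0) (use assms in auto)
  then have "g (u - u') = 0"
    by (intro S.f_eq_0_if_g_f_eq_0) (use assms in auto)
  then show ?thesis using assms by simp
qed

text \<open>All Penrose conditions follow from three properties of the pseudoinverse \<open>h\<close>: its values lie in
  the range of \<open>g\<close>, it satisfies \<open>g (f (h y)) = g y\<close>, and these two determine \<open>h y\<close>.\<close>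

lemma exists_pseudoinverse: "\<exists>h. is_pseudoinverse_on V ipV W ipW f h"
proof -
  obtain k where k: "\<And>y. y \<in> W \<Longrightarrow> k y \<in> W" "\<And>y. y \<in> W \<Longrightarrow> g (f (g (k y))) = g y"
    using exists_solution_in_range by metis
  define h where "h = (\<lambda>y. g (k y))"
  have h_in [simp]: "h y \<in> V" if "y \<in> W" for y using that k by (simp add: h_def)
  have gfh: "g (f (h y)) = g y" if "y \<in> W" for y using that k by (simp add: h_def)
  have h_unique: "h y = g u" if "y \<in> W" "u \<in> W" "g (f (g u)) = g y" for y u
    unfolding h_def by (rule solution_in_range_unique) (use that k in auto)
  have fhf: "f (h (f x)) = f x" if "x \<in> V" for x
  proof -
    have "f (h (f x) - x) = 0"
      by (rule f_eq_0_if_g_f_eq_0) (use that gfh in auto)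
    then show ?thesis using that by simp
  qed
  \<comment> \<open>Both \<open>f \<circ> h\<close> and \<open>h \<circ> f\<close> satisfy \<open>\<langle>Q x, x'\<rangle> = \<langle>Q x, Q x'\<rangle>\<close>; this makes them self-adjoint.\<close>
  have fh: "ipW (f (h y)) y' = ipW (f (h y)) (f (h y'))" if "y \<in> W" "y' \<in> W" for y y'
    using that gfh by (simp add: adjoint)
  have hf: "ipV (h (f x)) x' = ipV (h (f x)) (h (f x'))" if "x \<in> V" "x' \<in> V" for x x'
  proof -
    interpret S: adjoint_pair W ipW V ipV g f by (rule swap)
    show ?thesis using that fhf S.adjoint k(1) by (simp add: h_def)
  qed
  have "is_pseudoinverse_on V ipV W ipW f h"
    unfolding is_pseudoinverse_on_def linear_map_on_def
  proof (intro conjI ballI allI)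
    show "h (x + y) = h x + h y" if "x \<in> W" "y \<in> W" for x y
      using h_unique[of "x + y" "k x + k y"] that k by (simp add: h_def)
    show "h (\<lambda>i. r * x i) = (\<lambda>j. r * h x j)" if "x \<in> W" for r x
      using h_unique[of "\<lambda>i. r * x i" "\<lambda>i. r * k x i"] that k by (simp add: h_def)
    show "h (f (h y)) = h y" if "y \<in> W" for y
      using h_unique[of "f (h y)" "k y"] that k by (simp add: h_def)
    show "ipW (f (h y)) y' = ipW y (f (h y'))" if "y \<in> W" "y' \<in> W" for y y'
      using that fh[of y y'] fh[of y' y] W.ip_commute by simp
    show "ipV (h (f x)) x' = ipV x (h (f x'))" if "x \<in> V" "x' \<in> V" for x x'
      using that hf[of x x'] hf[of x' x] V.ip_commute by simp
  qed (simp_all add: fhf)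
  then show ?thesis by blast
qed

lemma gram_self_adjoint: "adjoint_pair W ipW W ipW (f \<circ> g) (f \<circ> g)"
proof
  show "linear_map_on W W (f \<circ> g)" by (rule linear_map_on_compose[OF lin_adj lin])
  then show "is_adjoint_on W ipW W ipW (f \<circ> g) (f \<circ> g)"
    using adjoint W.ip_commute V.ip_commute by (simp add: is_adjoint_on_def)
qed

end

section \<open>The effective resistance operator as a projection\<close>

text \<open>The abstract setting of effective resistance: \<open>f\<close> is the boundary map, \<open>g\<close> its adjoint,
  \<open>f \<circ> g\<close> the up Laplacian and \<open>g \<circ> P \<circ> f\<close> the resistance operator.\<close>

locale resistance = adjoint_pair +
  fixes P
  assumes pinv: "is_pseudoinverse_on W ipW W ipW (f \<circ> g) P"
begin

lemma lin_P: "linear_map_on W W P"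
  and gram_P_gram: "y \<in> W \<Longrightarrow> f (g (P (f (g y)))) = f (g y)"
  and gram_P_self_adjoint: "y \<in> W \<Longrightarrow> y' \<in> W \<Longrightarrow> ipW (f (g (P y))) y' = ipW y (f (g (P y')))"
  using pinv by (auto simp: is_pseudoinverse_on_def)

lemmas P_simps [simp] = linear_map_onD[OF lin_P]

lemma linear_resistance: "linear_map_on V V (g \<circ> P \<circ> f)"
  by (intro linear_map_on_compose[OF lin] linear_map_on_compose[OF lin_P] lin_adj)

text \<open>The operator \<open>f g P\<close> is the orthogonal projection to the range of \<open>f g\<close>, and that range is
  the whole range of \<open>f\<close>: the residual \<open>r\<close> of \<open>f x\<close> is orthogonal to the range of \<open>f g\<close>, which
  forces \<open>g r = 0\<close>, and then \<open>r\<close> is orthogonal to the range of \<open>f\<close>, in which it lies.\<close>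

lemma gram_P_f:
  assumes x: "x \<in> V"
  shows "f (g (P (f x))) = f x"
proof -
  interpret S: adjoint_pair W ipW V ipV g f by (rule swap)
  define r where "r = f (x - g (P (f x)))"
  have r_eq: "r = f x - f (g (P (f x)))" using x by (simp add: r_def)
  have r: "r \<in> W" using x by (simp add: r_def)
  have "ipW y (f (g r)) = 0" if y: "y \<in> W" for y
  proof -
    have "ipW y (f (g r)) = ipW (f (g y)) r" using y r by (simp add: adjoint S.adjoint)
    also have "\<dots> = ipW (f (g y)) (f x) - ipW (f (g y)) (f (g (P (f x))))"
      using x y by (simp add: r_eq W.ip_diff_right)
    also have "ipW (f (g y)) (f (g (P (f x)))) = ipW (f (g (P (f (g y))))) (f x)"
      using x y by (simp add: gram_P_self_adjoint)
    finally show ?thesis using y by (simp add: gram_P_gram)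
  qed
  then have "f (g r) = 0" using r W.ip_eq_0[of "f (g r)"] by simp
  then have "g r = 0" by (intro S.f_eq_0_if_g_f_eq_0) (use r in auto)
  then have "ipW r r = 0" using adjoint[of "x - g (P (f x))" r] x r by (simp add: r_def)
  then have "r = 0" by (rule W.ip_eq_0[OF r])
  then show ?thesis using r_eq by simp
qed

lemma resistance_form_eq:
  assumes "x \<in> V" "y \<in> V"
  shows "ipV (g (P (f x))) y = ipV (g (P (f x))) (g (P (f y)))"
proof -
  interpret S: adjoint_pair W ipW V ipV g f by (rule swap)
  show ?thesis using assms by (simp add: S.adjoint gram_P_f)
qed

end

section \<open>Chain spaces\<close>

lemma fin_inner_space_chains:
  assumes "finite_simplicial_complex K" "\<forall>\<sigma>\<in>K. 0 < w \<sigma>"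
  shows "fin_inner_space (chain_space K p) (chain_inner K w p)"
proof
  have fin: "finite (simplices K p)"
    using assms(1) by (simp add: finite_simplicial_complex_def simplices_def)
  have w: "0 < w \<sigma>" if "\<sigma> \<in> simplices K p" for \<sigma>
    using assms(2) that by (simp add: simplices_def)
  define e :: "'a set \<Rightarrow> 'a set \<Rightarrow> real" where "e = (\<lambda>\<sigma> \<tau>. if \<tau> = \<sigma> then 1 else 0)"
  let ?B = "e ` simplices K p"
  have "fun_vs.span ?B = chain_space K p"
  proof
    have "fun_vs.subspace (chain_space K p)"
      by (auto simp: fun_vs.subspace_def chain_space_def)
    then show "fun_vs.span ?B \<subseteq> chain_space K p"
      by (intro fun_vs.span_minimal) (auto simp: e_def chain_space_def)
    show "chain_space K p \<subseteq> fun_vs.span ?B"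
    proof
      fix c assume c: "c \<in> chain_space K p"
      have "(\<Sum>\<sigma>\<in>simplices K p. (\<lambda>\<tau>. c \<sigma> * e \<sigma> \<tau>)) = c"
      proof
        fix \<tau>
        have "(\<Sum>\<sigma>\<in>simplices K p. (\<lambda>\<tau>. c \<sigma> * e \<sigma> \<tau>)) \<tau> = (\<Sum>\<sigma>\<in>simplices K p. c \<sigma> * e \<sigma> \<tau>)"
          using fin by (induction rule: finite_induct) auto
        also have "\<dots> = (\<Sum>\<sigma>\<in>simplices K p. if \<tau> = \<sigma> then c \<sigma> else 0)"
          by (rule sum.cong) (auto simp: e_def)
        also have "\<dots> = c \<tau>"
          using fin c by (auto simp: chain_space_def)
        finally show "(\<Sum>\<sigma>\<in>simplices K p. (\<lambda>\<tau>. c \<sigma> * e \<sigma> \<tau>)) \<tau> = c \<tau>" .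
      qed
      moreover have "(\<Sum>\<sigma>\<in>simplices K p. (\<lambda>\<tau>. c \<sigma> * e \<sigma> \<tau>)) \<in> fun_vs.span ?B"
        by (intro fun_vs.span_sum fun_vs.span_scale fun_vs.span_base imageI)
      ultimately show "c \<in> fun_vs.span ?B" by simp
    qed
  qed
  then show "\<exists>B. finite B \<and> fun_vs.span B = chain_space K p" using fin by blast
  fix x y z :: "'a set \<Rightarrow> real" and r :: real
  show "chain_inner K w p x y = chain_inner K w p y x"
    by (simp add: chain_inner_def mult.commute)
  show "chain_inner K w p (x + y) z = chain_inner K w p x z + chain_inner K w p y z"
    by (simp add: chain_inner_def algebra_simps sum.distrib)
  show "chain_inner K w p (\<lambda>i. r * x i) z = r * chain_inner K w p x z"
    by (simp add: chain_inner_def sum_distrib_left algebra_simps)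
  have nonneg: "0 \<le> x \<sigma> * x \<sigma> * inverse (w \<sigma>)" if "\<sigma> \<in> simplices K p" for \<sigma>
    using w[OF that] by simp
  then show "0 \<le> chain_inner K w p x x"
    unfolding chain_inner_def by (rule sum_nonneg)
  show "x = 0" if x: "x \<in> chain_space K p" and "chain_inner K w p x x = 0"
  proof
    fix \<sigma>
    have "\<forall>\<sigma>\<in>simplices K p. x \<sigma> * x \<sigma> * inverse (w \<sigma>) = 0"
      using sum_nonneg_eq_0_iff[OF fin nonneg] that(2) by (simp add: chain_inner_def)
    then have "x \<sigma> = 0" if "\<sigma> \<in> simplices K p" for \<sigma>
      using that w[OF that] by fastforce
    then show "x \<sigma> = 0 \<sigma>" using x by (cases "\<sigma> \<in> simplices K p") (auto simp: chain_space_def)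
  qed
qed

lemma chain_space_diff: "a \<in> chain_space K p \<Longrightarrow> b \<in> chain_space K p \<Longrightarrow> a - b \<in> chain_space K p"
  by (simp add: chain_space_def)

lemma linear_boundary: "linear_map_on (chain_space K p) (chain_space K (p - 1)) (boundary K p)"
proof -
  have add: "(if P then c * (x + y) \<sigma> else 0) =
      (if P then c * x \<sigma> else 0) + (if P then c * y \<sigma> else (0::real))"
    for P c \<sigma> and x y :: "'a set \<Rightarrow> real" by (simp add: algebra_simps)
  have scale: "(if P then c * (r * x) else 0) = r * (if P then c * x else (0::real))"
    for P c r x by simp
  show ?thesis
    unfolding linear_map_on_def
  proof (intro conjI ballI allI)
    show "boundary K p x \<in> chain_space K (p - 1)" for x
      by (simp add: boundary_def chain_space_def)
    show "boundary K p (x + y) = boundary K p x + boundary K p y" for x y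
      by (simp add: boundary_def fun_eq_iff add sum.distrib)
    show "boundary K p (\<lambda>i. r * x i) = (\<lambda>j. r * boundary K p x j)" for r x
      by (simp add: boundary_def fun_eq_iff scale sum_distrib_left)
  qed
qed

text \<open>The adjoint and the pseudoinverse exist, so the choices in their definitions satisfy the
  defining conditions.\<close>

lemma resistance_boundary:
  fixes p :: int
  assumes "finite_simplicial_complex K" "\<forall>\<sigma>\<in>K. 0 < w \<sigma>"
  defines "W \<equiv> chain_space K (p - 1)" and "ipW \<equiv> chain_inner K w (p - 1)"
  shows "resistance (chain_space K p) (chain_inner K w p) W ipW (boundary K p) (coboundary K w p)
    (pseudoinverse_on W ipW W ipW (up_laplacian K w (p - 1)))"
proof -
  note spaces = fin_inner_space_chains[OF assms(1,2)]
  have adj: "is_adjoint_on (chain_space K p) (chain_inner K w p) W ipW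
      (boundary K p) (coboundary K w p)"
    unfolding coboundary_def adjoint_on_def W_def ipW_def
    by (rule someI_ex[OF exists_adjoint[OF spaces spaces linear_boundary]])
  interpret adjoint_pair "chain_space K p" "chain_inner K w p" W ipW "boundary K p" "coboundary K w p"
    using adj unfolding W_def ipW_def
    by (intro adjoint_pair.intro adjoint_pair_axioms.intro spaces linear_boundary)
  have "up_laplacian K w (p - 1) = boundary K p \<circ> coboundary K w p"
    by (simp add: up_laplacian_def)
  moreover have "is_pseudoinverse_on W ipW W ipW (boundary K p \<circ> coboundary K w p)
      (pseudoinverse_on W ipW W ipW (boundary K p \<circ> coboundary K w p))"
    unfolding pseudoinverse_on_def
    by (rule someI_ex[OF adjoint_pair.exists_pseudoinverse[OF gram_self_adjoint]])
  ultimately show ?thesis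
    by (intro resistance.intro resistance_axioms.intro adjoint_pair_axioms) simp
qed

section \<open>The distances on chains and on cycles\<close>

context
  fixes K :: "'a::linorder set set" and w :: "'a set \<Rightarrow> real"
  assumes K: "finite_simplicial_complex K" and w: "\<forall>\<sigma>\<in>K. 0 < w \<sigma>"
begin

lemma chain_norm_nonneg: "0 \<le> chain_norm K w p a"
  using w by (auto simp: chain_norm_def chain_inner_def simplices_def less_imp_le
    intro!: sum_nonneg)

lemma chain_norm_zero: "chain_norm K w p 0 = 0"
  by (simp add: chain_norm_def chain_inner_def)

lemma chain_norm_diff_commute: "chain_norm K w p (a - b) = chain_norm K w p (b - a)"
  by (simp add: chain_norm_def chain_inner_def algebra_simps)

lemma chain_norm_eq_0_iff:
  assumes "a \<in> chain_space K p"
  shows "chain_norm K w p a = 0 \<longleftrightarrow> a = 0"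
proof -
  interpret fin_inner_space "chain_space K p" "chain_inner K w p"
    by (rule fin_inner_space_chains[OF K w])
  show ?thesis using assms ip_eq_0 by (auto simp: chain_norm_def)
qed

text \<open>This form of the norm gives access to Minkowski's inequality.\<close>

lemma chain_norm_eq_L2_set:
  "chain_norm K w p a = L2_set (\<lambda>\<sigma>. a \<sigma> * sqrt (inverse (w \<sigma>))) (simplices K p)"
proof -
  have "a \<sigma> * a \<sigma> * inverse (w \<sigma>) = (a \<sigma> * sqrt (inverse (w \<sigma>)))\<^sup>2" if "\<sigma> \<in> simplices K p" for \<sigma>
    using w that by (simp add: simplices_def power_mult_distrib power2_eq_square less_imp_le)
  then show ?thesis by (simp add: chain_norm_def chain_inner_def L2_set_def)
qed

lemma chain_norm_triangle: "chain_norm K w p (a + b) \<le> chain_norm K w p a + chain_norm K w p b"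
  unfolding chain_norm_eq_L2_set
  using L2_set_triangle_ineq[of "\<lambda>\<sigma>. a \<sigma> * sqrt (inverse (w \<sigma>))" "\<lambda>\<sigma>. b \<sigma> * sqrt (inverse (w \<sigma>))"]
  by (simp add: algebra_simps)

lemma linear_resistance_operator:
  "linear_map_on (chain_space K p) (chain_space K p) (resistance_operator K w p)"
  unfolding resistance_operator_def
  by (rule resistance.linear_resistance[OF resistance_boundary[OF K w]])

lemma resistance_operator_diff:
  "a \<in> chain_space K p \<Longrightarrow> b \<in> chain_space K p \<Longrightarrow>
    resistance_operator K w p (a - b) = resistance_operator K w p a - resistance_operator K w p b"
  by (rule linear_map_on_diff[OF linear_resistance_operator
      fin_inner_space.subspace[OF fin_inner_space_chains[OF K w]]])

lemma boundary_resistance_operator: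
  "a \<in> chain_space K p \<Longrightarrow> boundary K p (resistance_operator K w p a) = boundary K p a"
  using resistance.gram_P_f[OF resistance_boundary[OF K w]] by (simp add: resistance_operator_def)

lemma resistance_operator_cong_boundary:
  "boundary K p a = boundary K p b \<Longrightarrow> resistance_operator K w p a = resistance_operator K w p b"
  by (simp add: resistance_operator_def)

lemma sqrt_resistance_form:
  assumes "a \<in> chain_space K p"
  shows "sqrt (resistance_form K w p a a) = chain_norm K w p (resistance_operator K w p a)"
  using resistance.resistance_form_eq[OF resistance_boundary[OF K w] assms assms]
  by (simp add: resistance_form_def resistance_operator_def chain_norm_def)

lemma chain_dist_eq_norm:
  assumes "a \<in> chain_space K p" "b \<in> chain_space K p"
  shows "chain_dist K w p a b = chain_norm K w p (resistance_operator K w p a - resistance_operator K w p b)"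
  using sqrt_resistance_form[OF chain_space_diff[OF assms]] resistance_operator_diff[OF assms]
  by (simp add: chain_dist_def)

lemma pseudometric_chain_dist: "pseudometric_on (chain_space K p) (chain_dist K w p)"
  unfolding pseudometric_on_def
proof (intro conjI ballI)
  fix x y z assume V: "x \<in> chain_space K p" "y \<in> chain_space K p" "z \<in> chain_space K p"
  let ?T = "resistance_operator K w p"
  show "chain_dist K w p x z \<le> chain_dist K w p x y + chain_dist K w p y z"
    using chain_norm_triangle[of p "?T x - ?T y" "?T y - ?T z"] V by (simp add: chain_dist_eq_norm)
qed (simp_all add: chain_dist_eq_norm chain_norm_nonneg chain_norm_zero chain_norm_diff_commute)

lemma cycle_dist_eq_norm:
  assumes "b \<in> chain_space K (p + 1)" "boundary K (p + 1) b = c - c'"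
  shows "cycle_dist K w p c c' = chain_norm K w (p + 1) (resistance_operator K w (p + 1) b)"
proof -
  define b' where "b' = (SOME b. b \<in> chain_space K (p + 1) \<and> boundary K (p + 1) b = c - c')"
  have b': "b' \<in> chain_space K (p + 1) \<and> boundary K (p + 1) b' = c - c'"
    unfolding b'_def using assms
    by (intro someI[of "\<lambda>b. b \<in> chain_space K (p + 1) \<and> boundary K (p + 1) b = c - c'" b] conjI)
  have "cycle_dist K w p c c' = sqrt (resistance_form K w (p + 1) b' b')"
    using assms by (auto simp: cycle_dist_def b'_def Let_def)
  also have "\<dots> = chain_norm K w (p + 1) (resistance_operator K w (p + 1) b')"
    using b' by (simp add: sqrt_resistance_form)
  also have "resistance_operator K w (p + 1) b' = resistance_operator K w (p + 1) b"
    by (rule resistance_operator_cong_boundary) (simp add: b' assms)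
  finally show ?thesis .
qed

lemma cycle_dist_nonneg: "0 \<le> cycle_dist K w p c c'"
proof (cases "\<exists>b\<in>chain_space K (p + 1). boundary K (p + 1) b = c - c'")
  case True
  then show ?thesis using cycle_dist_eq_norm chain_norm_nonneg by metis
qed (simp add: cycle_dist_def)

lemma boundary_filling_reverse:
  assumes "b \<in> chain_space K q" "boundary K q b = c - c'"
  shows "0 - b \<in> chain_space K q" "boundary K q (0 - b) = c' - c"
proof -
  have zero: "0 \<in> chain_space K q" by (simp add: chain_space_def)
  then show "0 - b \<in> chain_space K q" using assms(1) chain_space_diff by blast
  show "boundary K q (0 - b) = c' - c"
    using linear_map_on_diff[OF linear_boundary
        fin_inner_space.subspace[OF fin_inner_space_chains[OF K w]] zero assms(1)]
      linear_map_on_zero[OF linear_boundary zero] assms(2) by simp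
qed

lemma cycle_dist_commute: "cycle_dist K w p c c' = cycle_dist K w p c' c"
proof (cases "\<exists>b\<in>chain_space K (p + 1). boundary K (p + 1) b = c - c'")
  case True
  then obtain b where b: "b \<in> chain_space K (p + 1)" "boundary K (p + 1) b = c - c'" by blast
  have zero: "0 \<in> chain_space K (p + 1)" by (simp add: chain_space_def)
  have "resistance_operator K w (p + 1) (0 - b) = 0 - resistance_operator K w (p + 1) b"
    using resistance_operator_diff[OF zero b(1)]
      linear_map_on_zero[OF linear_resistance_operator zero] by simp
  then show ?thesis
    using cycle_dist_eq_norm[OF b] cycle_dist_eq_norm[OF boundary_filling_reverse[OF b]]
      chain_norm_diff_commute[of "p + 1" 0 "resistance_operator K w (p + 1) b"] by simp
next
  case False
  then have "\<not> (\<exists>b\<in>chain_space K (p + 1). boundary K (p + 1) b = c' - c)"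
    using boundary_filling_reverse by blast
  with False show ?thesis by (simp add: cycle_dist_def)
qed

text \<open>This is where a metric arises and not only a pseudometric: as \<open>T b\<close> has the same boundary as
  \<open>b\<close>, a filling \<open>b\<close> of \<open>c - c'\<close> can have \<open>T b = 0\<close> only if \<open>c = c'\<close>.\<close>

lemma Metric_space_cycle_dist:
  assumes fill: "\<And>c c'. c \<in> M \<Longrightarrow> c' \<in> M \<Longrightarrow>
      \<exists>b\<in>chain_space K (p + 1). boundary K (p + 1) b = c - c'"
  shows "Metric_space M (cycle_dist K w p)"
proof
  let ?T = "resistance_operator K w (p + 1)"
  note T_lin = linear_map_onD[OF linear_resistance_operator]
    and D_lin = linear_map_onD[OF linear_boundary]
  show "0 \<le> cycle_dist K w p c c'" for c c' by (rule cycle_dist_nonneg)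
  show "cycle_dist K w p c c' = cycle_dist K w p c' c" for c c' by (rule cycle_dist_commute)
  show "cycle_dist K w p c c' = 0 \<longleftrightarrow> c = c'" if M: "c \<in> M" "c' \<in> M" for c c'
  proof -
    have zero: "0 \<in> chain_space K (p + 1)" by (simp add: chain_space_def)
    obtain b where b: "b \<in> chain_space K (p + 1)" "boundary K (p + 1) b = c - c'"
      using fill M by blast
    have "cycle_dist K w p c c' = 0 \<longleftrightarrow> ?T b = 0"
      using cycle_dist_eq_norm[OF b] chain_norm_eq_0_iff[OF T_lin(1)[OF b(1)]] by simp
    also have "\<dots> \<longleftrightarrow> boundary K (p + 1) b = 0"
    proof
      assume "?T b = 0"
      then show "boundary K (p + 1) b = 0"
        using boundary_resistance_operator[OF b(1)] linear_map_on_zero[OF linear_boundary zero] by simp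
    next
      assume "boundary K (p + 1) b = 0"
      then have "?T b = ?T 0"
        by (intro resistance_operator_cong_boundary) (simp add: linear_map_on_zero[OF linear_boundary zero])
      then show "?T b = 0" using linear_map_on_zero[OF linear_resistance_operator zero] by simp
    qed
    finally show ?thesis using b(2) by simp
  qed
  show "cycle_dist K w p x z \<le> cycle_dist K w p x y + cycle_dist K w p y z"
    if M: "x \<in> M" "y \<in> M" "z \<in> M" for x y z
  proof -
    obtain a where a: "a \<in> chain_space K (p + 1)" "boundary K (p + 1) a = x - y"
      using fill M by blast
    obtain b where b: "b \<in> chain_space K (p + 1)" "boundary K (p + 1) b = y - z"
      using fill M by blast
    have ab: "a + b \<in> chain_space K (p + 1)" "boundary K (p + 1) (a + b) = x - z"
      using a b by (simp add: chain_space_def) (simp add: D_lin(2)[OF a(1) b(1)] a b)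
    show ?thesis
      using chain_norm_triangle[of "p + 1" "?T a" "?T b"]
      by (simp add: cycle_dist_eq_norm[OF a] cycle_dist_eq_norm[OF b] cycle_dist_eq_norm[OF ab]
        T_lin(2)[OF a(1) b(1)])
  qed
qed

text \<open>A reduced cycle lies in its own homology class because 0 is a boundary.\<close>

lemma reduced_cycle_is_boundary:
  assumes "reduced_homology K p = {boundaries K p}" "z \<in> reduced_cycles K p"
  shows "z \<in> boundaries K p"
proof -
  have zero: "0 \<in> chain_space K (p + 1)" by (simp add: chain_space_def)
  then have "0 \<in> boundaries K p"
    unfolding boundaries_def using linear_map_on_zero[OF linear_boundary zero] by (metis imageI)
  then have "z \<in> homologous K p `` {z}"
    using assms(2) by (simp add: homologous_def)
  moreover have "homologous K p `` {z} \<in> reduced_homology K p"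
    unfolding reduced_homology_def using assms(2) by (rule quotientI)
  ultimately show ?thesis unfolding assms(1) by blast
qed

lemma exists_filling:
  assumes "reduced_homology K p = {boundaries K p}"
    and c: "c \<in> cycles K p" "c' \<in> cycles K p"
    and aug: "p = 0 \<Longrightarrow> augmentation K c = augmentation K c'"
  shows "\<exists>b\<in>chain_space K (p + 1). boundary K (p + 1) b = c - c'"
proof -
  have "boundary K p (c - c') = boundary K p c - boundary K p c'"
    using linear_map_on_diff[OF linear_boundary
      fin_inner_space.subspace[OF fin_inner_space_chains[OF K w]]] c by (simp add: cycles_def)
  then have "c - c' \<in> reduced_cycles K p"
    using c aug
    by (simp add: chain_space_diff reduced_cycles_def cycles_def augmentation_def sum_subtractf)
  then have "c - c' \<in> boundaries K p"
    by (rule reduced_cycle_is_boundary[OF assms(1)])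
  then show ?thesis unfolding boundaries_def by (metis imageE)
qed

end

theorem theorem7p1:
  fixes K :: "'a::linorder set set" and w :: "'a set \<Rightarrow> real" and p :: int
  assumes "finite_simplicial_complex K"
    and "\<forall>\<sigma>\<in>K. 0 < w \<sigma>"
    and "0 \<le> p"
  shows
    "((\<forall>\<alpha>\<in>chain_space K p. \<forall>\<alpha>'\<in>chain_space K p.
         chain_dist K w p \<alpha> \<alpha>' = chain_norm K w p (resistance_operator K w p (\<alpha> - \<alpha>'))) \<and>
      pseudometric_on (chain_space K p) (chain_dist K w p))
     \<and>
     (reduced_homology K p = {boundaries K p} \<longrightarrow>
       (\<forall>c\<in>cycles K p. \<forall>c'\<in>cycles K p. (p = 0 \<longrightarrow> augmentation K c = augmentation K c') \<longrightarrow>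
          (\<exists>\<beta>\<in>chain_space K (p + 1). boundary K (p + 1) \<beta> = c - c')) \<and>
       (\<forall>c\<in>cycles K p. \<forall>c'\<in>cycles K p. \<forall>\<beta>\<in>chain_space K (p + 1). boundary K (p + 1) \<beta> = c - c' \<longrightarrow>
          cycle_dist K w p c c' = sqrt (resistance_form K w (p + 1) \<beta> \<beta>) \<and>
          cycle_dist K w p c c' = chain_norm K w (p + 1) (resistance_operator K w (p + 1) \<beta>)) \<and>
       (0 < p \<longrightarrow> Metric_space (cycles K p) (cycle_dist K w p)) \<and>
       (p = 0 \<longrightarrow> (\<forall>t. Metric_space {c \<in> cycles K p. augmentation K c = t} (cycle_dist K w p))))"
proof -
  note K = assms(1,2)
  have dist: "chain_dist K w p \<alpha> \<alpha>' = chain_norm K w p (resistance_operator K w p (\<alpha> - \<alpha>'))"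
    if "\<alpha> \<in> chain_space K p" "\<alpha>' \<in> chain_space K p" for \<alpha> \<alpha>'
    using sqrt_resistance_form[OF K chain_space_diff[OF that]] by (simp add: chain_dist_def)
  show ?thesis
  proof (intro conjI impI ballI allI)
    assume H: "reduced_homology K p = {boundaries K p}"
    note fill = exists_filling[OF K H]
    show "\<exists>\<beta>\<in>chain_space K (p + 1). boundary K (p + 1) \<beta> = c - c'"
      if "c \<in> cycles K p" "c' \<in> cycles K p" "p = 0 \<longrightarrow> augmentation K c = augmentation K c'" for c c'
      using fill that by blast
    show "Metric_space (cycles K p) (cycle_dist K w p)" if "0 < p"
      by (rule Metric_space_cycle_dist[OF K], rule fill) (use that in auto)
    show "Metric_space {c \<in> cycles K p. augmentation K c = t} (cycle_dist K w p)" for t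
      by (rule Metric_space_cycle_dist[OF K], rule fill) auto
    fix c c' \<beta> assume \<beta>: "\<beta> \<in> chain_space K (p + 1)" "boundary K (p + 1) \<beta> = c - c'"
    show norm: "cycle_dist K w p c c' = chain_norm K w (p + 1) (resistance_operator K w (p + 1) \<beta>)"
      by (rule cycle_dist_eq_norm[OF K \<beta>])
    show "cycle_dist K w p c c' = sqrt (resistance_form K w (p + 1) \<beta> \<beta>)"
      unfolding norm by (rule sqrt_resistance_form[OF K \<beta>(1), symmetric])
  qed (use dist pseudometric_chain_dist[OF K] in auto)
qed

end
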